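(* Let $h\geq 2$ be an integer, let $m_0=2h(2h-1)$, $m_1=(2h+1)(2h-1)$, $m_2=2h(2h+1)$, $m_3=2h(2h+1)+(2h-1)$, and let $\Gamma_h=\langle m_0,m_1,m_2,m_3\rangle$. Then every element of $\mathrm{Ap}(\Gamma_h,m_0)$ has a unique expression; that is, for every $x\in \mathrm{Ap}(\Gamma_h,m_0)$ there is exactly one vector $(s_0,s_1,s_2,s_3)$ of non-negative integers with $x=s_0m_0+s_1m_1+s_2m_2+s_3m_3$.
   Context: $\langle a_1,\dots,a_e\rangle$ denotes the set of all non-negative integer combinations of $a_1,\dots,a_e$. For a numerical semigroup $\Gamma$ and $0\neq a\in\Gamma$, the Apéry set is $\mathrm{Ap}(\Gamma,a)=\{s\in\Gamma\mid s-a\notin\Gamma\}$. *)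

theory Defs
  imports Main
begin

text \<open>Semigroups are subsets of \<open>int\<close> rather than \<open>nat\<close>, so that the difference in the definition
  of the Apery set is the genuine one: on \<open>nat\<close>, \<open>s - a\<close> would be \<open>0\<close> for \<open>s < a\<close>.\<close>

definition generated_semigroup :: "int list \<Rightarrow> int set" where
  "generated_semigroup as =
     {x. \<exists>c :: nat \<Rightarrow> nat. x = (\<Sum>i<length as. int (c i) * as ! i)}"

definition Apery :: "int set \<Rightarrow> int \<Rightarrow> int set" where
  "Apery \<Gamma> a = {s \<in> \<Gamma>. s - a \<notin> \<Gamma>}"

end

theory Submission
  imports Defs
begin

text \<open>Put \<open>n = 2 * h\<close>. The relations \<open>n * m1 = (n + 1) * m0\<close>, \<open>(n - 1) * m2 = (n + 1) * m0\<close> and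
  \<open>m1 + m2 = m0 + m3\<close> force \<open>s0 = 0\<close>, \<open>s1 < n\<close>, \<open>s2 < n - 1\<close> and \<open>s1 = 0 \<or> s2 = 0\<close> in every expression
  of an Apery element. Given two expressions, reduce modulo the odd number \<open>n + 1\<close>,
  which divides \<open>m1\<close> and \<open>m2\<close>, while \<open>m3\<close> is congruent to \<open>-2\<close>: the coefficients of \<open>m3\<close> differ by a
  multiple of \<open>n + 1\<close>, and a nonzero multiple is too large for the bounds. What is left is
  \<open>(n - 1) * s1 + n * s2\<close>, and \<open>s1 < n\<close> determines both coefficients.\<close>

lemma generated_semigroup_four_iff:
  "x \<in> generated_semigroup [a, b, c, d] \<longleftrightarrow>
     (\<exists>s0 s1 s2 s3 :: nat. x = int s0 * a + int s1 * b + int s2 * c + int s3 * d)"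
  (is "_ \<longleftrightarrow> ?R")
proof
  assume "x \<in> generated_semigroup [a, b, c, d]"
  then show ?R
    by (force simp: generated_semigroup_def eval_nat_numeral)
next
  assume ?R
  then obtain s0 s1 s2 s3 :: nat
    where x: "x = int s0 * a + int s1 * b + int s2 * c + int s3 * d"
    by blast
  show "x \<in> generated_semigroup [a, b, c, d]"
    unfolding generated_semigroup_def
    by (rule CollectI, rule exI[where x = "\<lambda>i. [s0, s1, s2, s3] ! i"])
       (simp add: x eval_nat_numeral)
qed

text \<open>Integer coefficients allow an expression with subtracted terms to be written down before
  the signs are known.\<close>

lemma generated_semigroup_fourI:
  assumes "x = s0 * a + s1 * b + s2 * c + s3 * d"
    and "0 \<le> s0" "0 \<le> s1" "0 \<le> s2" "0 \<le> s3"
  shows "x \<in> generated_semigroup [a, b, c, d]"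
  unfolding generated_semigroup_four_iff
  by (intro exI[where x = "nat s0"] exI[where x = "nat s1"] exI[where x = "nat s2"]
        exI[where x = "nat s3"]) (use assms in simp)

context
  fixes n m0 m1 m2 m3 :: int
  assumes n: "n \<ge> 2"
    and m0: "m0 = n * (n - 1)"
    and m1: "m1 = (n + 1) * (n - 1)"
    and m2: "m2 = n * (n + 1)"
    and m3: "m3 = n * (n + 1) + (n - 1)"
begin

text \<open>Each relation between the generators rewrites \<open>x - m0\<close>. Since
  \<open>x - m0\<close> lies outside the semigroup, some coefficient must be negative, and only a
  lowered one can be.\<close>

lemma Apery_coeff_bounds:
  assumes ap: "x \<in> Apery (generated_semigroup [m0, m1, m2, m3]) m0"
    and x: "x = s0 * m0 + s1 * m1 + s2 * m2 + s3 * m3"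
    and nonneg: "0 \<le> s0" "0 \<le> s1" "0 \<le> s2" "0 \<le> s3"
  shows "s0 = 0" "s1 < n" "s2 < n - 1" "s1 = 0 \<or> s2 = 0"
proof -
  have no: "\<not> (0 \<le> t0 \<and> 0 \<le> t1 \<and> 0 \<le> t2 \<and> 0 \<le> t3)"
    if "x - m0 = t0 * m0 + t1 * m1 + t2 * m2 + t3 * m3" for t0 t1 t2 t3
    using ap generated_semigroup_fourI[OF that] by (auto simp: Apery_def)
  have "x - m0 = (s0 - 1) * m0 + s1 * m1 + s2 * m2 + s3 * m3"
    by (simp add: x algebra_simps)
  from no[OF this] show "s0 = 0" using nonneg by linarith
  \<comment> \<open>Trade \<open>n\<close> copies of \<open>m1\<close> for \<open>n + 1\<close>
    copies of \<open>m0\<close>, one of which cancels the subtracted \<open>m0\<close>.\<close>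
  have "x - m0 = (s0 + n) * m0 + (s1 - n) * m1 + s2 * m2 + s3 * m3"
    by (simp add: x m0 m1 algebra_simps)
  from no[OF this] show "s1 < n" using nonneg n by linarith
  have "x - m0 = (s0 + n) * m0 + s1 * m1 + (s2 - (n - 1)) * m2 + s3 * m3"
    by (simp add: x m0 m2 algebra_simps)
  from no[OF this] show "s2 < n - 1" using nonneg n by linarith
  have "x - m0 = s0 * m0 + (s1 - 1) * m1 + (s2 - 1) * m2 + (s3 + 1) * m3"
    by (simp add: x m0 m1 m2 m3 algebra_simps)
  from no[OF this] show "s1 = 0 \<or> s2 = 0" using nonneg by linarith
qed

text \<open>One-sided, so that the upper bounds concern the \<open>t\<close> side only: a surplus of
  \<open>m3\<close> on the left has to be paid for by \<open>t1 * m1 + t2 * m2\<close>. Used in both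
  directions it gives equality.\<close>

lemma m3_coeff_le:
  assumes even: "even n"
    and eq: "s1 * m1 + s2 * m2 + s3 * m3 = t1 * m1 + t2 * m2 + t3 * m3"
    and s: "0 \<le> s1" "0 \<le> s2"
    and t: "0 \<le> t1" "0 \<le> t2" "t1 < n" "t2 < n - 1" "t1 = 0 \<or> t2 = 0"
  shows "s3 \<le> t3"
proof (rule ccontr)
  assume "\<not> s3 \<le> t3"
  have pos: "0 \<le> m1" "0 \<le> m2" "0 < m3"
    using n by (simp_all add: m1 m2 m3 add_pos_nonneg)
  \<comment> \<open>Here \<open>m3 = (n + 1)^2 - 2\<close>, and \<open>n + 1\<close> is a factor of
    \<open>m1\<close> and \<open>m2\<close>.\<close>
  have "(s3 - t3) * 2 = (n + 1) * ((s1 - t1) * (n - 1) + (s2 - t2) * n + (s3 - t3) * (n + 1))"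
    using eq unfolding m1 m2 m3 by algebra
  then have "n + 1 dvd (s3 - t3) * 2"
    by (metis dvd_triv_left)
  moreover have "coprime (n + 1) 2"
    using even by simp
  ultimately have "n + 1 dvd s3 - t3"
    using coprime_dvd_mult_left_iff by blast
  then have "n + 1 \<le> s3 - t3"
    using \<open>\<not> s3 \<le> t3\<close> by (intro zdvd_imp_le) auto
  then have "(n + 1) * m3 \<le> (s3 - t3) * m3"
    using pos by (intro mult_right_mono) auto
  also have "\<dots> \<le> t1 * m1 + t2 * m2"
    using eq mult_nonneg_nonneg[OF s(1) pos(1)] mult_nonneg_nonneg[OF s(2) pos(2)]
    by (simp add: algebra_simps)
  \<comment> \<open>At most one of the two terms is nonzero, so a single \<open>n * m2\<close>
    suffices.\<close>
  also have "\<dots> \<le> n * m2"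
  proof -
    have "m1 \<le> m2"
      using n by (simp add: m1 m2 algebra_simps)
    then have "t1 * m1 \<le> n * m2"
      using t pos n by (intro mult_mono) auto
    moreover have "t2 * m2 \<le> n * m2"
      using t pos by (intro mult_right_mono) auto
    ultimately show ?thesis
      using t(5) by auto
  qed
  also have "n * m2 < (n + 1) * m3"
    using n pos by (intro mult_strict_mono) (auto simp: m2 m3)
  finally show False by simp
qed

lemma Apery_coeffs_unique:
  assumes "even n"
    and ap: "x \<in> Apery (generated_semigroup [m0, m1, m2, m3]) m0"
    and s: "x = s0 * m0 + s1 * m1 + s2 * m2 + s3 * m3"
    and s_nonneg: "0 \<le> s0" "0 \<le> s1" "0 \<le> s2" "0 \<le> s3"
    and t: "x = t0 * m0 + t1 * m1 + t2 * m2 + t3 * m3"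
    and t_nonneg: "0 \<le> t0" "0 \<le> t1" "0 \<le> t2" "0 \<le> t3"
  shows "s0 = t0 \<and> s1 = t1 \<and> s2 = t2 \<and> s3 = t3"
proof -
  note sb = Apery_coeff_bounds[OF ap s s_nonneg]
  note tb = Apery_coeff_bounds[OF ap t t_nonneg]
  have eq: "s1 * m1 + s2 * m2 + s3 * m3 = t1 * m1 + t2 * m2 + t3 * m3"
    using s t sb(1) tb(1) by simp
  have s3: "s3 = t3"
    using m3_coeff_le[OF \<open>even n\<close> eq _ _ _ _ tb(2-4)]
      m3_coeff_le[OF \<open>even n\<close> eq[symmetric] _ _ _ _ sb(2-4)] s_nonneg t_nonneg
    by simp
  have "(n + 1) * ((s1 - t1) * (n - 1) + (s2 - t2) * n) = 0"
    using eq unfolding s3 m1 m2 by algebra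
  then have lin: "(s1 - t1) * (n - 1) + (s2 - t2) * n = 0"
    using n by simp
  \<comment> \<open>With \<open>a = s1 - t1\<close> and \<open>b = s2 - t2\<close>, the equation
    \<open>a * (n - 1) + b * n = 0\<close> reads \<open>a = n * (a + b)\<close>.\<close>
  then have "s1 - t1 = n * (s1 - t1 + s2 - t2)"
    by (simp add: algebra_simps)
  then have "n dvd s1 - t1"
    by (metis dvd_triv_left)
  moreover have "\<bar>s1 - t1\<bar> < n"
    using sb(2) tb(2) s_nonneg t_nonneg by linarith
  ultimately have "s1 = t1"
    using zdvd_not_zless[of "\<bar>s1 - t1\<bar>" n] by fastforce
  then show ?thesis
    using lin n s3 sb(1) tb(1) by simp
qed

end

theorem theorem3p2:
  fixes h m0 m1 m2 m3 :: int and \<Gamma> :: "int set"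
  assumes "h \<ge> 2"
    and "m0 = 2 * h * (2 * h - 1)"
    and "m1 = (2 * h + 1) * (2 * h - 1)"
    and "m2 = 2 * h * (2 * h + 1)"
    and "m3 = 2 * h * (2 * h + 1) + (2 * h - 1)"
    and "\<Gamma> = generated_semigroup [m0, m1, m2, m3]"
  shows "\<forall>x \<in> Apery \<Gamma> m0. \<exists>!s :: nat \<times> nat \<times> nat \<times> nat.
           case s of (s0, s1, s2, s3) \<Rightarrow>
             x = int s0 * m0 + int s1 * m1 + int s2 * m2 + int s3 * m3"
proof
  fix x
  assume x: "x \<in> Apery \<Gamma> m0"
  have n: "2 * h \<ge> 2"
    using assms(1) by simp
  note unique = Apery_coeffs_unique[OF n assms(2-5) _ x[unfolded assms(6)]]
  obtain s0 s1 s2 s3 :: nat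
    where s: "x = int s0 * m0 + int s1 * m1 + int s2 * m2 + int s3 * m3"
    using x unfolding assms(6) Apery_def mem_Collect_eq generated_semigroup_four_iff by blast
  show "\<exists>!s :: nat \<times> nat \<times> nat \<times> nat. case s of (s0, s1, s2, s3) \<Rightarrow>
          x = int s0 * m0 + int s1 * m1 + int s2 * m2 + int s3 * m3"
  proof (rule ex1I[where a = "(s0, s1, s2, s3)"])
    fix t :: "nat \<times> nat \<times> nat \<times> nat"
    assume t: "case t of (t0, t1, t2, t3) \<Rightarrow>
      x = int t0 * m0 + int t1 * m1 + int t2 * m2 + int t3 * m3"
    obtain t0 t1 t2 t3 where t_def: "t = (t0, t1, t2, t3)"
      by (cases t)
    with t have "x = int t0 * m0 + int t1 * m1 + int t2 * m2 + int t3 * m3"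
      by simp
    \<comment> \<open>The uniqueness lemma compares integers; injectivity of \<open>int\<close>
      carries the equalities back to the naturals.\<close>
    from unique[OF _ this _ _ _ _ s] show "t = (s0, s1, s2, s3)"
      by (simp add: t_def)
  qed (use s in simp)
qed

end
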